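(* Let $r\ge1$, let $P_r(T_{2,2j+1})$ be the reduced $Sym^r$-coloured HOMFLY-PT polynomial of the $(2,2j+1)$ torus knot, and set $\hat P_r(T_{2,2j+1})=(a^{-2j}q^{2j})^r\,P_r(T_{2,2j+1})$. Then $$\lim_{j\to\infty}\hat P_r(T_{2,2j+1})=\frac{(1-a^2q^{2r})(1-a^2q^{2r+2})\cdots(1-a^2q^{4r-2})}{(1-q^{2r+2})(1-q^{2r+4})\cdots(1-q^{4r})}.$$
   Context: The limit is taken coefficientwise in formal power series in $q$ (with coefficients polynomial in $a$), the right-hand side being expanded in positive powers of $q$. The polynomials are given explicitly by the known formula $$P_r(T_{2,2j+1})=a^{2jr}q^{-2jr}\sum_{0\le k_j\le\cdots\le k_1\le r}\begin{bmatrix}r\\k_1\end{bmatrix}\begin{bmatrix}k_1\\k_2\end{bmatrix}\cdots\begin{bmatrix}k_{j-1}\\k_j\end{bmatrix}\,q^{2(2r+1)(k_1+\cdots+k_j)-2rk_1-2\sum_{i=1}^{j-1}k_ik_{i+1}}\prod_{i=1}^{k_1}\bigl(1-a^2q^{2(i-2)}\bigr),$$ with unbalanced $q$-binomials $\begin{bmatrix}n\\k\end{bmatrix}=\frac{[n]!}{[k]!\,[n-k]!}$, $[n]!=\prod_{i=1}^n[i]$, $[n]=\frac{1-q^{2n}}{1-q^2}$. For example $P_2(T_{2,3})=a^4(q^{-4}+q^2+q^4+q^8)-a^6(1+q^2+q^6+q^8)+a^8q^6$. *)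

theory Defs
  imports "HOL-Computational_Algebra.Computational_Algebra"
begin

definition q_int :: "'a::field \<Rightarrow> nat \<Rightarrow> 'a" where
  "q_int q n = (1 - q ^ (2 * n)) / (1 - q ^ 2)"

definition q_fact :: "'a::field \<Rightarrow> nat \<Rightarrow> 'a" where
  "q_fact q n = (\<Prod>i=1..n. q_int q i)"

text \<open>Only ever used with \<open>k \<le> n\<close>, so that the subtraction does not truncate.\<close>

definition q_binom :: "'a::field \<Rightarrow> nat \<Rightarrow> nat \<Rightarrow> 'a" where
  "q_binom q n k = q_fact q n / (q_fact q k * q_fact q (n - k))"

text \<open>
  The tuples \<open>0 \<le> k\<^sub>j \<le> \<dots> \<le> k\<^sub>1 \<le> r\<close>, as extensional functions on \<open>{1..j}\<close>.
\<close>

definition chains :: "nat \<Rightarrow> nat \<Rightarrow> (nat \<Rightarrow> nat) set" where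
  "chains r j = {k \<in> {1..j} \<rightarrow>\<^sub>E {0..r}. \<forall>i\<in>{1..<j}. k (i + 1) \<le> k i}"

text \<open>
  The reduced \<open>Sym\<^sup>r\<close>-coloured HOMFLY-PT polynomial of the \<open>(2, 2j+1)\<close> torus knot, for
  \<open>j \<ge> 1\<close>, given by its known explicit formula. It is a Laurent polynomial in \<open>a\<close> and \<open>q\<close>, here
  evaluated at elements \<open>a\<close> and \<open>q\<close> of a field; \<open>q\<close> is meant to be nonzero and not a root of unity.
  For \<open>j = 0\<close> the value is meaningless, since \<open>k\<^sub>1\<close> does not exist.
\<close>

definition homfly_sym_torus :: "'a::field \<Rightarrow> 'a \<Rightarrow> nat \<Rightarrow> nat \<Rightarrow> 'a" where
  "homfly_sym_torus a q r j =
     a powi (2 * int j * int r) * q powi (- 2 * int j * int r) *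
     (\<Sum>k\<in>chains r j.
        q_binom q r (k 1) * (\<Prod>i\<in>{1..<j}. q_binom q (k i) (k (i + 1))) *
        q powi (2 * (2 * int r + 1) * (\<Sum>i=1..j. int (k i)) - 2 * int r * int (k 1)
                - 2 * (\<Sum>i\<in>{1..<j}. int (k i) * int (k (i + 1)))) *
        (\<Prod>i=1..k 1. 1 - a ^ 2 * q powi (2 * (int i - 2))))"

definition homfly_sym_torus_hat :: "'a::field \<Rightarrow> 'a \<Rightarrow> nat \<Rightarrow> nat \<Rightarrow> 'a" where
  "homfly_sym_torus_hat a q r j =
     (a powi (- 2 * int j) * q powi (2 * int j)) ^ r * homfly_sym_torus a q r j"

text \<open>
  All of the above is carried out in the field of formal Laurent series in \<open>q\<close> over the field of
  rational functions in \<open>a\<close>. Division in that field expands in positive powers of \<open>q\<close>.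
\<close>

definition var_a :: "int poly fract fls" where
  "var_a = fls_const (to_fract [:0, 1:])"

definition var_q :: "int poly fract fls" where
  "var_q = fls_X"

text \<open>
  The inclusion of the ring of formal power series in \<open>q\<close> whose coefficients are polynomials in
  \<open>a\<close>. The topology of \<^typ>\<open>int poly fps\<close> is that of coefficientwise convergence, the coefficients
  being discrete (see \<open>tendsto_fps_iff\<close>).
\<close>

definition of_poly_fps :: "int poly fps \<Rightarrow> int poly fract fls" where
  "of_poly_fps F = fps_to_fls (Abs_fps (\<lambda>n. to_fract (fps_nth F n)))"

lemma inj_of_poly_fps: "inj of_poly_fps"
  by (rule injI) (simp add: of_poly_fps_def fps_eq_iff)

end

theory Submission
  imports Defs
begin

text \<open>
  Write \<open>Q = q\<^sup>2\<close>, \<open>A = a\<^sup>2\<close> and \<open>k\<^sub>0 = r\<close>. The term \<open>- 2 r k\<^sub>1\<close> in the exponent is then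
  \<open>- 2 k\<^sub>0 k\<^sub>1\<close>, so the normalised polynomial is obtained by iterating the operator
  \<open>g(n) \<mapsto> \<Sum>\<^sub>k [n, k] Q\<^bsup>(2r+1-n)k\<^esup> g(k)\<close> on the constant function \<open>1\<close> and then applying it once
  more with the extra factor \<open>(A/Q; Q)\<^sub>k\<close>. By a form of the \<open>q\<close>-Vandermonde identity,
  \<open>g(n) = 1 / ((1 - Q\<^bsup>2r\<^esup>) \<cdots> (1 - Q\<^bsup>2r-n+1\<^esup>))\<close> is a fixed point of the operator. Since every
  iterate has value \<open>1\<close> at \<open>0\<close> and the summands with \<open>k \<ge> 1\<close> carry a positive power of \<open>Q\<close>, each
  iteration improves the congruence to the fixed point by a factor \<open>Q\<close>. A second use of the same
  identity evaluates the last, modified application at the fixed point.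
\<close>

subsection \<open>Gaussian binomials and the iterated sum\<close>

text \<open>The \<open>q\<close>-Pascal recurrence avoids division, so the coefficients make sense
  over \<open>int poly fps\<close>, which is not a field.\<close>

fun gauss_binom :: "'a::comm_ring_1 \<Rightarrow> nat \<Rightarrow> nat \<Rightarrow> 'a" where
  "gauss_binom q n 0 = 1"
| "gauss_binom q 0 (Suc k) = 0"
| "gauss_binom q (Suc n) (Suc k) = q ^ Suc k * gauss_binom q n (Suc k) + gauss_binom q n k"

text \<open>
  This is \<open>x\<^sup>n (z/x; q)\<^sub>n\<close>. The homogeneous form avoids the division, so that it makes sense for the
  factor \<open>(A/Q; Q)\<^sub>k\<close> in the ring of power series.
\<close>

definition q_shifted :: "'a::comm_ring_1 \<Rightarrow> 'a \<Rightarrow> 'a \<Rightarrow> nat \<Rightarrow> 'a" where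
  "q_shifted q x z n = (\<Prod>i<n. x - z * q ^ i)"

lemma gauss_binom_eq_0: "n < k \<Longrightarrow> gauss_binom q n k = 0"
  by (induction q n k rule: gauss_binom.induct) auto

lemma q_shifted_0 [simp]: "q_shifted q x z 0 = 1"
  by (simp add: q_shifted_def)

lemma q_shifted_Suc: "q_shifted q x z (Suc n) = (x - z) * q_shifted q x (q * z) n"
  by (simp add: q_shifted_def prod.lessThan_Suc_shift algebra_simps del: prod.lessThan_Suc)

lemma q_shifted_mult: "q_shifted q (c * x) (c * z) n = c ^ n * q_shifted q x z n"
proof -
  have "q_shifted q (c * x) (c * z) n = (\<Prod>i<n. c * (x - z * q ^ i))"
    unfolding q_shifted_def by (intro prod.cong) (simp_all add: algebra_simps)
  then show ?thesis
    by (simp add: prod.distrib q_shifted_def)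
qed

lemma sum_gauss_binom_Suc:
  "(\<Sum>k\<le>Suc n. gauss_binom q (Suc n) k * f k) =
   (\<Sum>k\<le>n. gauss_binom q n k * (q ^ k * f k + f (Suc k)))"
proof -
  have "(\<Sum>k\<le>Suc n. gauss_binom q (Suc n) k * f k) =
        (f 0 + (\<Sum>k\<le>n. q ^ Suc k * gauss_binom q n (Suc k) * f (Suc k))) +
        (\<Sum>k\<le>n. gauss_binom q n k * f (Suc k))"
    by (subst sum.atMost_Suc_shift) (simp add: algebra_simps sum.distrib)
  also have "f 0 + (\<Sum>k\<le>n. q ^ Suc k * gauss_binom q n (Suc k) * f (Suc k)) =
             (\<Sum>k\<le>Suc n. q ^ k * gauss_binom q n k * f k)"
    by (subst sum.atMost_Suc_shift) simp
  also have "\<dots> = (\<Sum>k\<le>n. q ^ k * gauss_binom q n k * f k)"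
    by (simp add: gauss_binom_eq_0)
  finally show ?thesis
    by (simp add: algebra_simps sum.distrib)
qed

text \<open>After one Pascal step, the first part gives the factor \<open>1 - x\<close> and absorbs
  \<open>q ^ k\<close> by homogeneity; the second gives \<open>x - z\<close>. By induction both
  remaining sums equal \<open>q_shifted q 1 (q * z) n\<close>, and the factors add up to
  \<open>1 - z\<close>.\<close>

lemma q_vandermonde:
  "(\<Sum>k\<le>n. gauss_binom q n k * (q_shifted q x z k * q_shifted q 1 x (n - k))) =
   q_shifted q 1 z n"
proof (induction n arbitrary: x z)
  case (Suc n)
  have "(\<Sum>k\<le>Suc n. gauss_binom q (Suc n) k *
           (q_shifted q x z k * q_shifted q 1 x (Suc n - k))) =
        (\<Sum>k\<le>n. gauss_binom q n k * (q ^ k * (q_shifted q x z k * q_shifted q 1 x (Suc n - k))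
           + q_shifted q x z (Suc k) * q_shifted q 1 x (Suc n - Suc k)))"
    by (rule sum_gauss_binom_Suc)
  also have "\<dots> = (\<Sum>k\<le>n.
      (1 - x) * (gauss_binom q n k * (q_shifted q (q * x) (q * z) k * q_shifted q 1 (q * x) (n - k)))
      + (x - z) * (gauss_binom q n k * (q_shifted q x (q * z) k * q_shifted q 1 x (n - k))))"
  proof (rule sum.cong)
    fix k assume "k \<in> {..n}"
    then show "gauss_binom q n k * (q ^ k * (q_shifted q x z k * q_shifted q 1 x (Suc n - k))
           + q_shifted q x z (Suc k) * q_shifted q 1 x (Suc n - Suc k)) =
      (1 - x) * (gauss_binom q n k * (q_shifted q (q * x) (q * z) k * q_shifted q 1 (q * x) (n - k)))
      + (x - z) * (gauss_binom q n k * (q_shifted q x (q * z) k * q_shifted q 1 x (n - k)))"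
      by (simp add: Suc_diff_le q_shifted_Suc q_shifted_mult algebra_simps)
  qed simp
  also have "\<dots> = ((1 - x) + (x - z)) * q_shifted q 1 (q * z) n"
    by (simp only: sum.distrib sum_distrib_left [symmetric] Suc.IH distrib_right)
  finally show ?case
    by (simp add: q_shifted_Suc)
qed simp

text \<open>\<open>N\<close> will be \<open>2 * r\<close>. For \<open>n \<le> N\<close> the
  subtraction does not truncate, and the exponent is positive for \<open>k \<ge> 1\<close>.\<close>

primrec chain_sum :: "'a::comm_ring_1 \<Rightarrow> nat \<Rightarrow> nat \<Rightarrow> nat \<Rightarrow> 'a" where
  "chain_sum q N 0 n = 1"
| "chain_sum q N (Suc j) n =
     (\<Sum>k\<le>n. gauss_binom q n k * (q ^ ((N + 1 - n) * k) * chain_sum q N j k))"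

text \<open>Here \<open>u m\<close> is an inverse of \<open>1 - q ^ m\<close>. Extending the product
  from \<open>k\<close> to \<open>n\<close> factors costs exactly the second shifted factorial of
  \<open>q_vandermonde\<close> at \<open>x = q ^ (N + 1 - n)\<close>. The case \<open>z = 0\<close>
  gives the fixed point; general \<open>z\<close> serves the last application.\<close>

lemma sum_gauss_binom_limit:
  fixes u :: "nat \<Rightarrow> 'a::comm_ring_1"
  assumes u: "\<And>m. 1 \<le> m \<Longrightarrow> m \<le> N \<Longrightarrow> u m * (1 - q ^ m) = 1" and "n \<le> N"
  shows "(\<Sum>k\<le>n. gauss_binom q n k * (q_shifted q (q ^ (N + 1 - n)) z k * (\<Prod>i<k. u (N - i)))) =
         q_shifted q 1 z n * (\<Prod>i<n. u (N - i))"
proof -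
  \<comment> \<open>Downward induction from \<open>k = n\<close>: removing \<open>u (N - k)\<close>
    is compensated by the factor \<open>1 - q ^ (N - k)\<close>.\<close>
  have g: "(\<Prod>i<k. u (N - i)) = q_shifted q 1 (q ^ (N + 1 - n)) (n - k) * (\<Prod>i<n. u (N - i))"
    if "k \<le> n" for k
    using that
  proof (induction "n - k" arbitrary: k)
    case (Suc m)
    then have k: "m = n - Suc k" "Suc k \<le> n" "n - k = Suc m" "N - k = N + 1 - n + m"
      using \<open>n \<le> N\<close> by linarith+
    have "(\<Prod>i<k. u (N - i)) = (1 - q ^ (N - k)) * (\<Prod>i<Suc k. u (N - i))"
    proof -
      have "u (N - k) * (1 - q ^ (N - k)) = 1"
        using k(2) \<open>n \<le> N\<close> by (intro u) simp_all
      moreover have "(1 - q ^ (N - k)) * (\<Prod>i<Suc k. u (N - i)) =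
                     (u (N - k) * (1 - q ^ (N - k))) * (\<Prod>i<k. u (N - i))"
        by (simp only: prod.lessThan_Suc mult_ac)
      ultimately show ?thesis by simp
    qed
    also have "\<dots> = (1 - q ^ (N + 1 - n + m)) * (q_shifted q 1 (q ^ (N + 1 - n)) m * (\<Prod>i<n. u (N - i)))"
      by (simp only: k(4) Suc.hyps(1) [OF k(1,2)] k(1) [symmetric])
    finally show ?case
      by (simp add: k(3) q_shifted_def power_add algebra_simps)
  qed simp
  have "(\<Sum>k\<le>n. gauss_binom q n k * (q_shifted q (q ^ (N + 1 - n)) z k * (\<Prod>i<k. u (N - i)))) =
     (\<Sum>k\<le>n. gauss_binom q n k * (q_shifted q (q ^ (N + 1 - n)) z k *
       q_shifted q 1 (q ^ (N + 1 - n)) (n - k))) * (\<Prod>i<n. u (N - i))"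
    unfolding sum_distrib_right by (intro sum.cong refl) (subst g, simp_all only: atMost_iff mult_ac)
  then show ?thesis
    by (simp only: q_vandermonde)
qed

lemma chain_sum_approx:
  fixes u :: "nat \<Rightarrow> 'a::comm_ring_1"
  assumes u: "\<And>m. 1 \<le> m \<Longrightarrow> m \<le> N \<Longrightarrow> u m * (1 - q ^ m) = 1" and "n \<le> N"
  shows "q ^ j dvd chain_sum q N j n - (\<Prod>i<n. u (N - i))"
  using \<open>n \<le> N\<close>
proof (induction j arbitrary: n)
  case (Suc j)
  \<comment> \<open>At \<open>z = 0\<close> the shifted factorial is the pure power
    \<open>q ^ ((N + 1 - n) * k)\<close>.\<close>
  have "(\<Prod>i<n. u (N - i)) =
        (\<Sum>k\<le>n. gauss_binom q n k * (q ^ ((N + 1 - n) * k) * (\<Prod>i<k. u (N - i))))"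
    using sum_gauss_binom_limit[of N u q n 0] u Suc.prems by (simp add: q_shifted_def power_mult)
  then have "chain_sum q N (Suc j) n - (\<Prod>i<n. u (N - i)) =
     (\<Sum>k\<le>n. gauss_binom q n k * (q ^ ((N + 1 - n) * k) *
        (chain_sum q N j k - (\<Prod>i<k. u (N - i)))))"
    by (simp add: sum_subtractf algebra_simps)
  also have "q ^ Suc j dvd \<dots>"
  proof (rule dvd_sum, rule dvd_mult)
    fix k assume k: "k \<in> {..n}"
    show "q ^ Suc j dvd q ^ ((N + 1 - n) * k) * (chain_sum q N j k - (\<Prod>i<k. u (N - i)))"
    \<comment> \<open>For \<open>k = 0\<close> both terms are 1 and cancel; for
      \<open>k \<ge> 1\<close> the prefactor supplies the additional \<open>q\<close>.\<close>
    proof (cases k)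
      case 0
      have "chain_sum q N j 0 = 1" for j
        by (induction j) simp_all
      with 0 show ?thesis by simp
    next
      case (Suc k')
      then have "1 \<le> (N + 1 - n) * k"
        using Suc.prems by simp
      then have "q ^ 1 dvd q ^ ((N + 1 - n) * k)"
        by (rule le_imp_power_dvd)
      moreover have "q ^ j dvd chain_sum q N j k - (\<Prod>i<k. u (N - i))"
        using Suc.IH[of k] k Suc.prems by simp
      ultimately have "q ^ 1 * q ^ j dvd q ^ ((N + 1 - n) * k) * (chain_sum q N j k - (\<Prod>i<k. u (N - i)))"
        by (rule mult_dvd_mono)
      then show ?thesis by simp
    qed
  qed
  finally show ?case .
qed simp

text \<open>With denominators cleared, this is an induction along Pascal's rule using
  \<open>q_int q (m + n) = q_int q m + (q ^ 2) ^ m * q_int q n\<close>. The hypothesis on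
  \<open>q\<close> keeps all \<open>q\<close>-factorials nonzero.\<close>

lemma gauss_binom_eq_q_binom:
  fixes q :: "'a::field"
  assumes q: "\<And>i. i \<ge> 1 \<Longrightarrow> q ^ (2 * i) \<noteq> 1" and "k \<le> n"
  shows "gauss_binom (q ^ 2) n k = q_binom q n k"
proof -
  have int_nz: "q_int q n \<noteq> 0" if "n \<ge> 1" for n
    using q[OF that] q[of 1] by (simp add: q_int_def)
  have fact_nz: "q_fact q n \<noteq> 0" for n
    unfolding q_fact_def using int_nz by simp
  have fact_Suc: "q_fact q (Suc n) = q_int q (Suc n) * q_fact q n" for n
    by (simp add: q_fact_def)
  have int_add: "q_int q (m + n) = q_int q m + (q ^ 2) ^ m * q_int q n" for m n
    using q[of 1] by (simp add: q_int_def divide_simps) (simp add: algebra_simps power_add flip: power_mult)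
  have "gauss_binom (q ^ 2) n k * (q_fact q k * q_fact q (n - k)) = q_fact q n"
    using \<open>k \<le> n\<close>
  proof (induction "q ^ 2" n k rule: gauss_binom.induct)
    case (3 n k)
    have IH: "gauss_binom (q ^ 2) n k * (q_fact q k * q_fact q (n - k)) = q_fact q n"
      using 3 by simp
    show ?case
    \<comment> \<open>At \<open>k = n\<close> the first Pascal summand vanishes, and the induction
      hypothesis for it, which needs \<open>Suc k \<le> n\<close>, does not apply.\<close>
    proof (cases "k = n")
      case True
      then show ?thesis
        using IH by (auto simp: gauss_binom_eq_0 fact_Suc q_fact_def [of q 0] mult_ac)
    next
      case False
      then obtain m where m: "n - k = Suc m" "n - Suc k = m" "Suc n = Suc k + Suc m"
        using 3(3) by (cases "n - k") auto
      have IH': "gauss_binom (q ^ 2) n (Suc k) * (q_fact q (Suc k) * q_fact q m) = q_fact q n"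
        using 3 False m by simp
      have "gauss_binom (q ^ 2) (Suc n) (Suc k) * (q_fact q (Suc k) * q_fact q (Suc n - Suc k)) =
         (q ^ 2) ^ Suc k * q_int q (Suc m) * (gauss_binom (q ^ 2) n (Suc k) * (q_fact q (Suc k) * q_fact q m))
         + q_int q (Suc k) * (gauss_binom (q ^ 2) n k * (q_fact q k * q_fact q (n - k)))"
        by (simp only: gauss_binom.simps diff_Suc_Suc m(1) fact_Suc) (simp add: algebra_simps)
      also have "\<dots> = q_int q (Suc n) * q_fact q n"
        unfolding IH IH' m(3) int_add by (simp add: algebra_simps)
      finally show ?thesis by (simp add: fact_Suc)
    qed
  qed (simp_all add: q_fact_def)
  then show ?thesis
    using fact_nz by (simp add: q_binom_def divide_simps)
qed

subsection \<open>The embedding as a ring homomorphism\<close>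

lemma of_poly_fps_1 [simp]: "of_poly_fps 1 = 1"
proof -
  have "Abs_fps (\<lambda>n. to_fract (fps_nth 1 n)) = (1 :: int poly fract fps)"
    by (simp add: fps_eq_iff)
  then show ?thesis by (simp add: of_poly_fps_def)
qed

lemma of_poly_fps_add [simp]: "of_poly_fps (F + G) = of_poly_fps F + of_poly_fps G"
  unfolding of_poly_fps_def fps_to_fls_plus [symmetric]
  by (rule arg_cong [where f = fps_to_fls]) (simp add: fps_eq_iff)

lemma of_poly_fps_diff [simp]: "of_poly_fps (F - G) = of_poly_fps F - of_poly_fps G"
  unfolding of_poly_fps_def fps_to_fls_minus [symmetric]
  by (rule arg_cong [where f = fps_to_fls]) (simp add: fps_eq_iff)

lemma of_poly_fps_mult [simp]: "of_poly_fps (F * G) = of_poly_fps F * of_poly_fps G"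
  unfolding of_poly_fps_def fls_times_fps_to_fls [symmetric]
  by (rule arg_cong [where f = fps_to_fls]) (simp add: fps_eq_iff fps_mult_nth)

lemma of_poly_fps_0 [simp]: "of_poly_fps 0 = 0"
  using of_poly_fps_diff [of 0 0] by simp

lemma of_poly_fps_power [simp]: "of_poly_fps (F ^ n) = of_poly_fps F ^ n"
  by (induction n) simp_all

lemma of_poly_fps_sum [simp]: "of_poly_fps (\<Sum>x\<in>S. f x) = (\<Sum>x\<in>S. of_poly_fps (f x))"
  by (induction S rule: infinite_finite_induct) simp_all

lemma of_poly_fps_prod [simp]: "of_poly_fps (\<Prod>x\<in>S. f x) = (\<Prod>x\<in>S. of_poly_fps (f x))"
  by (induction S rule: infinite_finite_induct) simp_all

lemma of_poly_fps_X [simp]: "of_poly_fps fps_X = var_q"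
proof -
  have "Abs_fps (\<lambda>n. to_fract (fps_nth fps_X n)) = (fps_X :: int poly fract fps)"
    by (simp add: fps_eq_iff fps_X_def)
  then show ?thesis by (simp add: of_poly_fps_def var_q_def)
qed

lemma of_poly_fps_const [simp]: "of_poly_fps (fps_const [:0, 1:]) = var_a"
proof -
  have "Abs_fps (\<lambda>n. to_fract (fps_nth (fps_const [:0, 1:]) n)) = fps_const (to_fract ([:0, 1:] :: int poly))"
    by (simp add: fps_eq_iff)
  then show ?thesis by (simp only: of_poly_fps_def var_a_def fps_const_to_fls)
qed

lemma of_poly_fps_gauss_binom [simp]:
  "of_poly_fps (gauss_binom q n k) = gauss_binom (of_poly_fps q) n k"
  by (induction q n k rule: gauss_binom.induct) simp_all

lemma of_poly_fps_q_shifted [simp]: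
  "of_poly_fps (q_shifted q x z n) = q_shifted (of_poly_fps q) (of_poly_fps x) (of_poly_fps z) n"
  by (simp add: q_shifted_def)

lemma of_poly_fps_chain_sum [simp]:
  "of_poly_fps (chain_sum q N j n) = chain_sum (of_poly_fps q) N j n"
  by (induction j arbitrary: n) simp_all

subsection \<open>Expansion of the sum over chains\<close>

lemma sum_chains_1: "(\<Sum>k\<in>chains r 1. f k) = (\<Sum>l\<le>r. f (\<lambda>i\<in>{1}. l))"
proof -
  have "bij_betw (\<lambda>l. \<lambda>i\<in>{1}. l) {..r} (chains r 1)"
    by (rule bij_betwI [where g = "\<lambda>k. k 1"])
       (auto simp: chains_def PiE_iff extensional_def fun_eq_iff)
  then show ?thesis
    by (rule sum.reindex_bij_betw [symmetric])
qed

text \<open>The last entry of a chain is bounded only by its predecessor, so it can be summed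
  first.\<close>

lemma sum_chains_Suc:
  assumes "j \<ge> 1"
  shows "(\<Sum>k\<in>chains r (Suc j). f k) = (\<Sum>k\<in>chains r j. \<Sum>l\<le>k j. f (k(Suc j := l)))"
proof -
  have le: "k j \<le> r" if "k \<in> chains r j" for k
    using that assms by (auto simp: chains_def PiE_iff)
  have fin: "finite (chains r j)"
    by (rule finite_subset [of _ "{1..j} \<rightarrow>\<^sub>E {0..r}"]) (auto simp: chains_def intro: finite_PiE)
  have "bij_betw (\<lambda>(k, l). k(Suc j := l)) (SIGMA k:chains r j. {..k j}) (chains r (Suc j))"
  \<comment> \<open>The inverse resets position \<open>Suc j\<close> to \<open>undefined\<close>
    because chains of length \<open>j\<close> are extensional on \<open>{1..j}\<close>.\<close>
  proof (rule bij_betwI [where g = "\<lambda>k. (k(Suc j := undefined), k (Suc j))"])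
    show "(\<lambda>(k, l). k(Suc j := l)) \<in> (SIGMA k:chains r j. {..k j}) \<rightarrow> chains r (Suc j)"
    proof clarify
      fix k l assume k: "k \<in> chains r j" "l \<le> k j"
      then have "l \<le> r"
        using le [of k] by simp
      then show "k(Suc j := l) \<in> chains r (Suc j)"
        using k assms by (auto simp: chains_def PiE_iff extensional_def less_Suc_eq)
    qed
    show "(\<lambda>k. (k(Suc j := undefined), k (Suc j))) \<in>
            chains r (Suc j) \<rightarrow> (SIGMA k:chains r j. {..k j})"
      using assms by (auto simp: chains_def PiE_iff extensional_def)
  qed (auto simp: chains_def PiE_iff extensional_def fun_eq_iff)
  then have "(\<Sum>k\<in>chains r (Suc j). f k) =
             (\<Sum>(k, l)\<in>(SIGMA k:chains r j. {..k j}). f (k(Suc j := l)))"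
    by (subst sum.reindex_bij_betw [symmetric]) (auto simp: case_prod_unfold)
  then show ?thesis
    using fin by (simp add: sum.Sigma)
qed

text \<open>This is the summand of \<open>homfly_sym_torus\<close>, isolated to track the effect of
  appending an entry to a chain.\<close>

definition chain_weight :: "'a::field \<Rightarrow> 'a \<Rightarrow> nat \<Rightarrow> nat \<Rightarrow> (nat \<Rightarrow> nat) \<Rightarrow> 'a" where
  "chain_weight a q r j k =
     q_binom q r (k 1) * (\<Prod>i\<in>{1..<j}. q_binom q (k i) (k (i + 1))) *
        q powi (2 * (2 * int r + 1) * (\<Sum>i=1..j. int (k i)) - 2 * int r * int (k 1)
                - 2 * (\<Sum>i\<in>{1..<j}. int (k i) * int (k (i + 1)))) *
        (\<Prod>i=1..k 1. 1 - a ^ 2 * q powi (2 * (int i - 2)))"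

text \<open>The power of \<open>q\<close> contributes \<open>(q ^ 2) ^ (r + 1)\<close> to each of
  the \<open>k 1\<close> factors of the product, which clears the negative exponent at
  \<open>i = 1\<close>.\<close>

lemma chain_weight_1:
  fixes q :: "'a::field"
  assumes "q \<noteq> 0"
  shows "chain_weight a q r 1 k = q_binom q r (k 1) *
           q_shifted (q ^ 2) ((q ^ 2) ^ (r + 1)) (a ^ 2 * (q ^ 2) ^ r) (k 1)"
proof -
  have "q powi (2 * (2 * int r + 1) * int (k 1) - 2 * int r * int (k 1)) =
        (q ^ 2) ^ ((r + 1) * k 1)"
  proof -
    have "2 * (2 * int r + 1) * int (k 1) - 2 * int r * int (k 1) = int (2 * ((r + 1) * k 1))"
      by (simp add: algebra_simps)
    then show ?thesis
      by (simp only: power_int_of_nat power_mult)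
  qed
  moreover have "(q ^ 2) ^ ((r + 1) * n) * (\<Prod>i=1..n. 1 - a ^ 2 * q powi (2 * (int i - 2))) =
        q_shifted (q ^ 2) ((q ^ 2) ^ (r + 1)) (a ^ 2 * (q ^ 2) ^ r) n" for n
  proof (induction n)
    case (Suc n)
    have "q ^ (2 * r + 2) * q powi (2 * (int (Suc n) - 2)) = q powi (int (2 * r + 2) + 2 * (int (Suc n) - 2))"
      using assms by (simp only: power_int_add power_int_of_nat simp_thms)
    also have "int (2 * r + 2) + 2 * (int (Suc n) - 2) = int (2 * r + 2 * n)"
      by simp
    also have "q powi int (2 * r + 2 * n) = (q ^ 2) ^ r * (q ^ 2) ^ n"
      by (simp only: power_int_of_nat power_add power_mult)
    also have "q ^ (2 * r + 2) = (q ^ 2) ^ (r + 1)"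
      by (simp only: power_mult [symmetric] distrib_left mult_1_right)
    finally have last: "(q ^ 2) ^ (r + 1) * (1 - a ^ 2 * q powi (2 * (int (Suc n) - 2))) =
        (q ^ 2) ^ (r + 1) - a ^ 2 * (q ^ 2) ^ r * (q ^ 2) ^ n"
      by (simp only: right_diff_distrib mult_1_right mult.assoc mult.left_commute [of _ "a ^ 2"])
    have "(q ^ 2) ^ ((r + 1) * Suc n) = (q ^ 2) ^ ((r + 1) * n) * (q ^ 2) ^ (r + 1)"
      by (simp only: power_add [symmetric] mult_Suc_right add.commute)
    moreover have "(\<Prod>i=1..Suc n. 1 - a ^ 2 * q powi (2 * (int i - 2))) =
        (\<Prod>i=1..n. 1 - a ^ 2 * q powi (2 * (int i - 2))) *
        (1 - a ^ 2 * q powi (2 * (int (Suc n) - 2)))"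
      by simp
    ultimately have "(q ^ 2) ^ ((r + 1) * Suc n) * (\<Prod>i=1..Suc n. 1 - a ^ 2 * q powi (2 * (int i - 2))) =
        (q ^ 2) ^ ((r + 1) * n) * (\<Prod>i=1..n. 1 - a ^ 2 * q powi (2 * (int i - 2))) *
        ((q ^ 2) ^ (r + 1) * (1 - a ^ 2 * q powi (2 * (int (Suc n) - 2))))"
      by (simp only: mult_ac)
    then show ?case
      unfolding Suc.IH last by (simp add: q_shifted_def)
  qed simp
  ultimately show ?thesis
    by (simp add: chain_weight_def mult.assoc)
qed

text \<open>Appending \<open>l\<close> raises the exponent by
  \<open>2 * (2 * r + 1) * l - 2 * k j * l\<close>, which is the weight in \<open>chain_sum\<close>
  with \<open>N = 2 * r\<close>.\<close>

lemma chain_weight_Suc: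
  fixes q :: "'a::field"
  assumes "q \<noteq> 0" "j \<ge> 1" "k j \<le> r"
  shows "chain_weight a q r (Suc j) (k(Suc j := l)) =
           chain_weight a q r j k * (q_binom q (k j) l * (q ^ 2) ^ ((2 * r + 1 - k j) * l))"
proof -
  let ?k = "k(Suc j := l)"
  let ?e = "\<lambda>j k. 2 * (2 * int r + 1) * (\<Sum>i=1..j. int (k i)) - 2 * int r * int (k 1)
                - 2 * (\<Sum>i\<in>{1..<j}. int (k i) * int (k (i + 1)))"
  have "int ((2 * r + 1 - k j) * l) = (2 * int r + 1 - int (k j)) * int l"
    using assms by simp
  then have "int (2 * ((2 * r + 1 - k j) * l)) = 2 * ((2 * int r + 1 - int (k j)) * int l)"
    by (simp only: of_nat_mult of_nat_numeral)
  then have "?e (Suc j) ?k = ?e j k + int (2 * ((2 * r + 1 - k j) * l))"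
    using assms by (simp add: algebra_simps)
  then have e: "q powi ?e (Suc j) ?k = q powi ?e j k * (q ^ 2) ^ ((2 * r + 1 - k j) * l)"
    using assms by (simp only: power_int_add power_int_of_nat power_mult simp_thms)
  have "(\<Prod>i\<in>{1..<Suc j}. q_binom q (?k i) (?k (i + 1))) =
        (\<Prod>i\<in>{1..<j}. q_binom q (k i) (k (i + 1))) * q_binom q (k j) l"
    using assms by (simp add: prod.atLeastLessThan_Suc)
  moreover have "?k 1 = k 1"
    using assms by simp
  ultimately show ?thesis
    unfolding chain_weight_def e by (simp add: mult_ac)
qed

lemma homfly_sym_torus_hat_eq:
  fixes a q :: "'a::field"
  assumes "a \<noteq> 0" "q \<noteq> 0" and q: "\<And>i. i \<ge> 1 \<Longrightarrow> q ^ (2 * i) \<noteq> 1" and "j \<ge> 1"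
  shows "homfly_sym_torus_hat a q r j =
    (\<Sum>k\<le>r. gauss_binom (q ^ 2) r k *
       (q_shifted (q ^ 2) ((q ^ 2) ^ (r + 1)) (a ^ 2 * (q ^ 2) ^ r) k * chain_sum (q ^ 2) (2 * r) (j - 1) k))"
proof -
  have gb: "gauss_binom (q ^ 2) n k = q_binom q n k" if "k \<le> n" for n k
    using gauss_binom_eq_q_binom [OF q that] .
  \<comment> \<open>Generalised over \<open>m\<close>, the number of innermost levels already
    absorbed into \<open>chain_sum\<close>; each induction step moves one more level there.\<close>
  have *: "(\<Sum>k\<in>chains r (Suc j). chain_weight a q r (Suc j) k * chain_sum (q ^ 2) (2 * r) m (k (Suc j))) =
    (\<Sum>k\<le>r. gauss_binom (q ^ 2) r k *
       (q_shifted (q ^ 2) ((q ^ 2) ^ (r + 1)) (a ^ 2 * (q ^ 2) ^ r) k * chain_sum (q ^ 2) (2 * r) (m + j) k))" for j m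
  proof (induction j arbitrary: m)
    case 0
    show ?case
      unfolding One_nat_def [symmetric] sum_chains_1
      by (intro sum.cong) (use assms in \<open>simp_all add: chain_weight_1 gb del: One_nat_def\<close>)
  next
    case (Suc j)
    have "k (Suc j) \<le> r" if "k \<in> chains r (Suc j)" for k
      using that by (auto simp: chains_def PiE_iff)
    then have "(\<Sum>k\<in>chains r (Suc (Suc j)). chain_weight a q r (Suc (Suc j)) k *
                 chain_sum (q ^ 2) (2 * r) m (k (Suc (Suc j)))) =
       (\<Sum>k\<in>chains r (Suc j). chain_weight a q r (Suc j) k * chain_sum (q ^ 2) (2 * r) (Suc m) (k (Suc j)))"
      using assms by (simp add: sum_chains_Suc chain_weight_Suc gb sum_distrib_left mult.assoc)
    then show ?case
      by (simp only: Suc.IH add_Suc add_Suc_right)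
  qed
  have "a powi (2 * int j * int r) = (a powi (2 * int j)) ^ r"
       "q powi (- 2 * int j * int r) = (q powi (- 2 * int j)) ^ r"
    by (simp_all only: power_int_mult power_int_of_nat)
  moreover have "a powi (- 2 * int j) * q powi (2 * int j) *
                 (a powi (2 * int j) * q powi (- 2 * int j)) = 1"
    using assms by (simp add: power_int_minus field_simps)
  ultimately have "(a powi (- 2 * int j) * q powi (2 * int j)) ^ r *
        (a powi (2 * int j * int r) * q powi (- 2 * int j * int r)) = 1"
    by (simp only: power_mult_distrib [symmetric] power_one)
  then have "homfly_sym_torus_hat a q r j = (\<Sum>k\<in>chains r j. chain_weight a q r j k)"
    by (simp add: homfly_sym_torus_hat_def homfly_sym_torus_def chain_weight_def flip: mult.assoc)
  then show ?thesis
    using * [of "j - 1" 0] \<open>j \<ge> 1\<close> by simp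
qed

subsection \<open>The limit\<close>

theorem propositionA1:
  fixes r :: nat
  assumes "r \<ge> 1"
  shows "\<exists>(P_hat :: nat \<Rightarrow> int poly fps) (L :: int poly fps).
           (\<forall>j\<ge>1. of_poly_fps (P_hat j) = homfly_sym_torus_hat var_a var_q r j) \<and>
           of_poly_fps L =
             (\<Prod>i=r..2*r-1. 1 - var_a ^ 2 * var_q ^ (2 * i)) /
             (\<Prod>i=r+1..2*r. 1 - var_q ^ (2 * i)) \<and>
           P_hat \<longlonglongrightarrow> L"
proof -
  define Q :: "int poly fps" where "Q = fps_X ^ 2"
  define z where "z = fps_const [:0, 1:] ^ 2 * Q ^ r"
  define w where "w k = q_shifted Q (Q ^ (r + 1)) z k" for k
  \<comment> \<open>Coefficients lie in \<open>int poly\<close>, so inversion uses the constant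
    coefficient 1, whose inverse 1 is the second argument.\<close>
  define u where "u m = fps_left_inverse (1 - Q ^ m) 1" for m
  \<comment> \<open>One of the \<open>j\<close> levels is the outer sum with weight
    \<open>w\<close>, leaving \<open>j - 1\<close> iterations.\<close>
  define P where "P j = (\<Sum>k\<le>r. gauss_binom Q r k * (w k * chain_sum Q (2 * r) (j - 1) k))" for j
  define L where "L = q_shifted Q 1 z r * (\<Prod>i<r. u (2 * r - i))"
  have u: "u m * (1 - Q ^ m) = 1" if "m \<ge> 1" for m
    unfolding u_def by (rule fps_left_inverse) (use that in \<open>simp add: Q_def flip: power_mult\<close>)
  \<comment> \<open>With \<open>N = 2 * r\<close> and \<open>n = r\<close>, the base
    \<open>Q ^ (N + 1 - n)\<close> is the \<open>Q ^ (r + 1)\<close> in \<open>w\<close>.\<close>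
  have L: "L = (\<Sum>k\<le>r. gauss_binom Q r k * (w k * (\<Prod>i<k. u (2 * r - i))))"
    using sum_gauss_binom_limit [of "2 * r" u Q r z] u unfolding L_def w_def by simp
  have "Q ^ (j - 1) dvd P j - L" for j
  proof -
    have "P j - L = (\<Sum>k\<le>r. gauss_binom Q r k *
            (w k * (chain_sum Q (2 * r) (j - 1) k - (\<Prod>i<k. u (2 * r - i)))))"
      unfolding P_def L by (simp add: sum_subtractf algebra_simps)
    also have "Q ^ (j - 1) dvd \<dots>"
      by (intro dvd_sum dvd_mult chain_sum_approx) (auto intro: u)
    finally show ?thesis .
  qed
  \<comment> \<open>Since \<open>Q = fps_X ^ 2\<close>, divisibility by \<open>Q ^ (j - 1)\<close>
    kills all coefficients of the difference below \<open>2 * (j - 1)\<close>.\<close>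
  then have coeff: "fps_nth (P j) n = fps_nth L n" if "n < 2 * (j - 1)" for j n
  proof -
    obtain R where "P j - L = fps_X ^ (2 * (j - 1)) * R"
      using \<open>Q ^ (j - 1) dvd P j - L\<close> by (auto simp: Q_def power_mult elim: dvdE)
    then have "fps_nth (P j - L) n = 0"
      using that by (simp add: fps_X_power_mult_nth)
    then show ?thesis by simp
  qed
  have lim: "P \<longlonglongrightarrow> L"
    unfolding tendsto_fps_iff
  proof
    fix n
    show "\<forall>\<^sub>F j in sequentially. fps_nth (P j) n = fps_nth L n"
      using eventually_ge_at_top [of "n + 2"] by eventually_elim (simp add: coeff)
  qed
  have q: "var_q ^ (2 * i) \<noteq> 1" if "i \<ge> 1" for i
  proof
    assume "var_q ^ (2 * i) = 1"
    then have "of_poly_fps (fps_X ^ (2 * i)) = of_poly_fps 1"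
      by simp
    then have "fps_X ^ (2 * i) = (1 :: int poly fps)"
      using inj_of_poly_fps by (rule injD [rotated])
    then have "fps_nth (fps_X ^ (2 * i)) 0 = fps_nth (1 :: int poly fps) 0"
      by (rule arg_cong)
    then show False
      using that by simp
  qed
  have "var_a \<noteq> 0" "var_q \<noteq> 0"
    by (simp_all add: var_a_def var_q_def)
  then have "of_poly_fps (P j) = homfly_sym_torus_hat var_a var_q r j" if "j \<ge> 1" for j
    using that q by (simp add: homfly_sym_torus_hat_eq P_def w_def z_def Q_def del: fps_const_power)
  moreover have "of_poly_fps L =
             (\<Prod>i=r..2*r-1. 1 - var_a ^ 2 * var_q ^ (2 * i)) /
             (\<Prod>i=r+1..2*r. 1 - var_q ^ (2 * i))"
  proof -
    have "(\<Prod>i<r. u (2 * r - i)) = (\<Prod>i=r+1..2*r. u i)"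
      by (rule prod.reindex_bij_witness [of _ "\<lambda>i. 2 * r - i" "\<lambda>i. 2 * r - i"]) auto
    \<comment> \<open>The quotient is checked in multiplied-out form, inside the power series ring,
      before passing to the Laurent field.\<close>
    then have "L * (\<Prod>i=r+1..2*r. 1 - Q ^ i) = q_shifted Q 1 z r"
      by (simp add: L_def mult.assoc u flip: prod.distrib)
    also have "\<dots> = (\<Prod>i=r..2*r-1. 1 - fps_const [:0, 1:] ^ 2 * Q ^ i)"
      unfolding q_shifted_def z_def
      by (rule prod.reindex_bij_witness [of _ "\<lambda>i. i - r" "\<lambda>i. i + r"])
         (use assms in \<open>auto simp: mult.assoc add.commute simp flip: power_add\<close>)
    finally have "of_poly_fps (L * (\<Prod>i=r+1..2*r. 1 - Q ^ i)) =
                  of_poly_fps (\<Prod>i=r..2*r-1. 1 - fps_const [:0, 1:] ^ 2 * Q ^ i)"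
      by simp
    moreover have "(\<Prod>i=r+1..2*r. 1 - var_q ^ (2 * i)) \<noteq> 0"
      using q by force
    ultimately show ?thesis
      by (simp add: Q_def eq_divide_eq del: fps_const_power flip: power_mult)
  qed
  ultimately show ?thesis
    using lim by blast
qed

end
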